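(* Let $G$ be a simple connected graph with $n$ vertices having diameter $d=2$, maximum vertex degree $\Delta(G)$ and independence number $\alpha(G)$. Then $$DLS(G)\geq \Delta(G)+\alpha(G)+1-n.$$
   Context: All graphs are finite, simple and connected. For a connected graph $G$ on vertices $v_1,\dots,v_n$, $d_{uv}$ denotes the distance (length of a shortest path) between $u$ and $v$, and $D(G)=(d_{uv})$ is the distance matrix. The diameter is the maximum distance between two vertices. The independence number $\alpha(G)$ is the maximum cardinality of a set of pairwise non-adjacent vertices. The transmission of a vertex $v$ is $Tr(v)=\sum_{u\in V(G)}d_{uv}$. The distance Laplacian matrix is $D^L(G)=\mathrm{diag}(Tr(v_1),\dots,Tr(v_n))-D(G)$; it is positive semidefinite, and its eigenvalues, with multiplicity, are written $\partial_1^L(G)\ge \partial_2^L(G)\ge\dots\ge\partial_n^L(G)=0$. The distance Laplacian spread is $DLS(G)=\partial_1^L(G)-\partial_{n-1}^L(G)$. *)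

theory Defs
  imports
    "Graph_Theory.Graph_Theory"
    "Jordan_Normal_Form.Char_Poly"
begin

text \<open>
  Finite simple graphs are modelled by the locale \<^locale>\<open>graph\<close> of \<open>Graph_Theory\<close>: finite,
  loop-free digraphs without parallel arcs and with symmetric adjacency, so every edge is
  a pair of opposite arcs.
\<close>

text \<open>
  The distance is the library's \<open>\<mu>\<close> with unit arc weights. It is an \<^typ>\<open>ereal\<close>, finite
  exactly on reachable pairs; \<open>real_of_ereal\<close> loses nothing on connected graphs
  (see \<open>gdist_eq_Least\<close> below).
\<close>

definition gdist :: "('a, 'b) pre_digraph \<Rightarrow> 'a \<Rightarrow> 'a \<Rightarrow> real" where
  "gdist G u v = real_of_ereal (wf_digraph.\<mu> G (\<lambda>_. 1) u v)"

definition diameter :: "('a, 'b) pre_digraph \<Rightarrow> real" where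
  "diameter G = Max {gdist G u v | u v. u \<in> verts G \<and> v \<in> verts G}"

text \<open>By symmetry and the absence of parallel arcs, the out-degree counts the neighbours.\<close>

definition max_degree :: "('a, 'b) pre_digraph \<Rightarrow> nat" where
  "max_degree G = Max (out_degree G ` verts G)"

definition independent_set :: "('a, 'b) pre_digraph \<Rightarrow> 'a set \<Rightarrow> bool" where
  "independent_set G S \<longleftrightarrow>
     S \<subseteq> verts G \<and> (\<forall>u\<in>S. \<forall>v\<in>S. u \<noteq> v \<longrightarrow> (u, v) \<notin> arcs_ends G)"

definition independence_number :: "('a, 'b) pre_digraph \<Rightarrow> nat" where
  "independence_number G = Max (card ` {S. independent_set G S})"

definition transmission :: "('a, 'b) pre_digraph \<Rightarrow> 'a \<Rightarrow> real" where
  "transmission G v = (\<Sum>u\<in>verts G. gdist G u v)"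

text \<open>
  In what follows \<open>vs\<close> is an enumeration of the vertices without repetitions; it fixes the
  order of the rows and columns.
\<close>

definition distance_matrix :: "('a, 'b) pre_digraph \<Rightarrow> 'a list \<Rightarrow> real mat" where
  "distance_matrix G vs =
     mat (length vs) (length vs) (\<lambda>(i, j). gdist G (vs ! i) (vs ! j))"

definition transmission_matrix :: "('a, 'b) pre_digraph \<Rightarrow> 'a list \<Rightarrow> real mat" where
  "transmission_matrix G vs =
     mat (length vs) (length vs) (\<lambda>(i, j). if i = j then transmission G (vs ! i) else 0)"

definition distance_Laplacian :: "('a, 'b) pre_digraph \<Rightarrow> 'a list \<Rightarrow> real mat" where
  "distance_Laplacian G vs = transmission_matrix G vs - distance_matrix G vs"

text \<open>
  The eigenvalues of a real square matrix with their (algebraic) multiplicities, in descending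
  order. Only real roots of the characteristic polynomial occur; for a symmetric matrix, such
  as the distance Laplacian, these are all of its roots and the list has length \<open>n\<close>.
\<close>

definition eigenvalues_desc :: "real mat \<Rightarrow> real list" where
  "eigenvalues_desc A = rev (sorted_list_of_multiset (proots (char_poly A)))"

text \<open>The \<open>i\<close>-th largest eigenvalue, counted from \<open>i = 1\<close>.\<close>

definition dL_eigenvalue :: "('a, 'b) pre_digraph \<Rightarrow> 'a list \<Rightarrow> nat \<Rightarrow> real" where
  "dL_eigenvalue G vs i = eigenvalues_desc (distance_Laplacian G vs) ! (i - 1)"

definition DLS :: "('a, 'b) pre_digraph \<Rightarrow> 'a list \<Rightarrow> real" where
  "DLS G vs = dL_eigenvalue G vs 1 - dL_eigenvalue G vs (length vs - 1)"


lemma gdist_eq_Least: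
  fixes G :: "('a, 'b) pre_digraph"
  assumes "graph G" "Digraph_Component.connected G" "u \<in> verts G" "v \<in> verts G"
  shows "wf_digraph.\<mu> G (\<lambda>_. 1) u v = ereal (gdist G u v)"
    and "gdist G u v = real (LEAST k. \<exists>p. pre_digraph.apath G u p v \<and> length p = k)"
proof -
  interpret graph G by fact
  have cost: "awalk_cost (\<lambda>_. 1) p = real (length p)" for p :: "'b list"
    by (induction p) (auto simp: awalk_cost_def)
  have "strongly_connected G"
    using assms(2) by (rule symmetric_connected_imp_strongly_connected[OF sym_arcs])
  then have "u \<rightarrow>\<^sup>*\<^bsub>G\<^esub> v"
    using assms(3,4) by (auto simp: strongly_connected_def)
  then obtain p where p: "apath u p v" "\<mu> (\<lambda>_. 1) u v = ereal (real (length p))"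
    using min_cost_awalk[of u v "\<lambda>_. 1"] by (auto simp: cost)
  have "length p \<le> length q" if "apath u q v" for q
    using min_cost_le_walk_cost[of u q v "\<lambda>_. 1"] that p(2)
    by (simp add: cost apath_def)
  then have "(LEAST k. \<exists>p. apath u p v \<and> length p = k) = length p"
    using p(1) by (intro Least_equality) auto
  then show "\<mu> (\<lambda>_. 1) u v = ereal (gdist G u v)"
    and "gdist G u v = real (LEAST k. \<exists>p. apath u p v \<and> length p = k)"
    using p(2) by (simp_all add: gdist_def)
qed

end

(*
  In diameter 2 the distances are 0, 1 and 2, so D^L = 2 n I - 2 J - L with L the ordinary
  Laplacian. Take two vertices u, v of a maximum independent set: the Rayleigh quotient of D^L at
  e_u - e_v is at least n + alpha, which bounds the largest eigenvalue from below. At a vertex c of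
  maximum degree, the vector equal to Delta at c, to -1 at its neighbours and to 0 elsewhere has
  Rayleigh quotient at least Delta + 1 for L. Hence L has an eigenvalue k >= Delta + 1; its
  eigenvector is orthogonal to the all-ones vector, so 2 n - k is an eigenvalue of D^L. It is
  nonzero, since D^L is positive semidefinite with the constants as kernel, and together with the
  eigenvalue 0 it bounds the second smallest eigenvalue by 2 n - Delta - 1.
*)
theory Submission
  imports Defs "HOL-Analysis.Function_Topology"
    "HOL-Computational_Algebra.Fundamental_Theorem_Algebra"
begin

section \<open>Real-rooted polynomials and spectra of real symmetric matrices\<close>

text \<open>Multiplicities are compared point by point. At a real \<open>z\<close> the embedding
  into the complex numbers preserves the order of the root; at a non-real \<open>z\<close> both
  counts are zero by real-rootedness.\<close>

lemma proots_map_poly_of_real: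
  fixes p :: "real poly"
  assumes "p \<noteq> 0" and "\<And>z. poly (map_poly complex_of_real p) z = 0 \<Longrightarrow> z \<in> \<real>"
  shows "proots (map_poly complex_of_real p) = image_mset complex_of_real (proots p)"
proof (rule multiset_eqI)
  fix z
  have nz: "map_poly complex_of_real p \<noteq> 0"
    using assms(1) by simp
  show "count (proots (map_poly complex_of_real p)) z = count (image_mset complex_of_real (proots p)) z"
  proof (cases "z \<in> \<real>")
    case True
    then obtain r where r: "z = complex_of_real r"
      by (auto elim: Reals_cases)
    interpret map_poly_inj_idom_divide_hom complex_of_real ..
    have "count (image_mset complex_of_real (proots p)) z = count (proots p) r"
    proof -
      have "complex_of_real -` {z} = {r}"
        by (auto simp: r)
      then show ?thesis
        by (cases "r \<in># proots p") (auto simp: count_image_mset not_in_iff simp del: count_proots)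
    qed
    then show ?thesis
      using assms(1) nz by (simp add: r order_hom)
  next
    case False
    then have "order z (map_poly complex_of_real p) = 0"
      using assms(2) by (metis order_0I)
    moreover have "z \<notin># image_mset complex_of_real (proots p)"
      using False by auto
    ultimately show ?thesis
      using nz by (simp add: not_in_iff del: set_image_mset set_count_proots)
  qed
qed

text \<open>The fundamental theorem of algebra gives degree many complex roots, and real-rootedness
  ensures that none of them is lost over the reals.\<close>

lemma size_proots_real_rooted:
  fixes p :: "real poly"
  assumes "p \<noteq> 0" and "\<And>z. poly (map_poly complex_of_real p) z = 0 \<Longrightarrow> z \<in> \<real>"
  shows "size (proots p) = degree p"
proof -
  have "size (proots p) = size (proots (map_poly complex_of_real p))"
    using proots_map_poly_of_real[OF assms] by simp
  then show ?thesis
    by (simp add: size_proots_complex)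
qed

text \<open>For an eigenvector \<open>v\<close>, the Hermitian form \<open>Q\<close> of
  \<open>A\<close> at \<open>v\<close> equals \<open>z\<close> times the squared norm
  \<open>N\<close>. Symmetry makes \<open>Q\<close> its own conjugate, and \<open>N\<close> is real
  and nonzero, so \<open>z\<close> is real.\<close>

lemma eigenvalue_real_symmetric_is_real:
  fixes A :: "real mat"
  assumes A: "A \<in> carrier_mat n n"
    and sym: "\<And>i j. i < n \<Longrightarrow> j < n \<Longrightarrow> A $$ (i, j) = A $$ (j, i)"
    and z: "eigenvalue (map_mat complex_of_real A) z"
  shows "z \<in> \<real>"
proof -
  obtain v where v: "v \<in> carrier_vec n" "v \<noteq> 0\<^sub>v n"
    and eq: "map_mat complex_of_real A *\<^sub>v v = z \<cdot>\<^sub>v v"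
    using z A by (auto simp: eigenvalue_def eigenvector_def)
  have row: "(\<Sum>j<n. complex_of_real (A $$ (i, j)) * v $ j) = z * v $ i" if "i < n" for i
  proof -
    have "(map_mat complex_of_real A *\<^sub>v v) $ i = (z \<cdot>\<^sub>v v) $ i"
      using eq by simp
    then show ?thesis
      using that A v(1) by (simp add: scalar_prod_def atLeast0LessThan)
  qed
  define N where "N = (\<Sum>i<n. (cmod (v $ i))\<^sup>2)"
  define Q where "Q = (\<Sum>i<n. \<Sum>j<n. cnj (v $ i) * (complex_of_real (A $$ (i, j)) * v $ j))"
  have "Q = (\<Sum>i<n. cnj (v $ i) * (z * v $ i))"
    unfolding Q_def by (intro sum.cong refl) (simp add: row flip: sum_distrib_left)
  also have "\<dots> = z * complex_of_real N"
    unfolding N_def of_real_sum sum_distrib_left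
    by (intro sum.cong refl) (simp add: complex_norm_square mult_ac del: of_real_power)
  finally have Q: "Q = z * complex_of_real N" .
  have "cnj Q = (\<Sum>i<n. \<Sum>j<n. cnj (v $ j) * (complex_of_real (A $$ (i, j)) * v $ i))"
    unfolding Q_def cnj_sum by (intro sum.cong refl) (simp add: mult_ac)
  also have "\<dots> = (\<Sum>j<n. \<Sum>i<n. cnj (v $ j) * (complex_of_real (A $$ (i, j)) * v $ i))"
    by (rule sum.swap)
  also have "\<dots> = Q"
    unfolding Q_def by (intro sum.cong refl) (use sym in simp)
  finally have "cnj Q = Q" .
  moreover have "N \<noteq> 0"
  proof
    assume "N = 0"
    then have "v $ i = 0" if "i < n" for i
      using that unfolding N_def by (subst (asm) sum_nonneg_eq_0_iff) auto
    then have "v = 0\<^sub>v n"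
      using v(1) by auto
    then show False
      using v(2) by simp
  qed
  ultimately have "cnj z = z"
    using Q by simp
  then show ?thesis
    by (simp add: Reals_cnj_iff)
qed

text \<open>This fixes the length of \<open>eigenvalues_desc\<close>, so that positions counted from
  the end of the list have their intended meaning.\<close>

lemma size_proots_char_poly_symmetric:
  fixes A :: "real mat"
  assumes A: "A \<in> carrier_mat n n"
    and sym: "\<And>i j. i < n \<Longrightarrow> j < n \<Longrightarrow> A $$ (i, j) = A $$ (j, i)"
  shows "size (proots (char_poly A)) = n"
proof -
  have "char_poly A \<noteq> 0"
    using degree_monic_char_poly[OF A] by auto
  moreover have "z \<in> \<real>" if "poly (map_poly complex_of_real (char_poly A)) z = 0" for z
  proof (rule eigenvalue_real_symmetric_is_real[OF A sym])
    show "eigenvalue (map_mat complex_of_real A) z"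
      using that A by (subst eigenvalue_root_char_poly[of _ n])
        (auto simp: of_real_hom.char_poly_hom[OF A])
  qed
  ultimately show ?thesis
    using size_proots_real_rooted degree_monic_char_poly[OF A] by metis
qed

section \<open>Positions in the descending list of eigenvalues\<close>

lemma set_eigenvalues_desc:
  assumes "A \<in> carrier_mat n n"
  shows "set (eigenvalues_desc A) = {k. eigenvalue A k}"
proof -
  have "char_poly A \<noteq> 0"
    using degree_monic_char_poly[OF assms] by auto
  then show ?thesis
    by (simp add: eigenvalues_desc_def eigenvalue_root_char_poly[OF assms] set_count_proots)
qed

lemma sorted_wrt_eigenvalues_desc: "sorted_wrt (\<ge>) (eigenvalues_desc A)"
  by (simp add: eigenvalues_desc_def sorted_wrt_rev)

lemma eigenvalues_desc_first_ge:
  assumes "A \<in> carrier_mat n n" "eigenvalue A k"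
  shows "k \<le> eigenvalues_desc A ! 0"
proof -
  obtain i where "i < length (eigenvalues_desc A)" "k = eigenvalues_desc A ! i"
    using set_eigenvalues_desc[OF assms(1)] assms(2)
    by (metis in_set_conv_nth mem_Collect_eq)
  then show ?thesis
    using sorted_wrt_eigenvalues_desc[of A] by (cases i) (auto simp: sorted_wrt_iff_nth_less)
qed

text \<open>Two distinct eigenvalues occupy two different positions among
  \<open>0, ..., n - 1\<close>, so at least one of them stands at position \<open>n - 2\<close> or
  earlier. As the list descends, the entry at \<open>n - 2\<close> is at most that
  eigenvalue.\<close>

lemma eigenvalues_desc_second_last_le:
  fixes A :: "real mat"
  assumes A: "A \<in> carrier_mat n n"
    and sym: "\<And>i j. i < n \<Longrightarrow> j < n \<Longrightarrow> A $$ (i, j) = A $$ (j, i)"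
    and ev: "eigenvalue A k" "eigenvalue A l" "k \<noteq> l" and le: "k \<le> t" "l \<le> t"
  shows "eigenvalues_desc A ! (n - 2) \<le> t"
proof -
  let ?e = "eigenvalues_desc A"
  have len: "length ?e = n"
    using size_proots_char_poly_symmetric[OF A sym]
    by (simp add: eigenvalues_desc_def flip: size_mset)
  obtain i j where ij: "i < n" "k = ?e ! i" "j < n" "l = ?e ! j"
    using set_eigenvalues_desc[OF A] ev len by (metis in_set_conv_nth mem_Collect_eq)
  have dec: "?e ! b \<le> ?e ! a" if "a \<le> b" "b < n" for a b
    using sorted_wrt_eigenvalues_desc[of A] that len
    by (cases "a = b") (auto simp: sorted_wrt_iff_nth_less)
  have "i \<noteq> j"
    using ij ev(3) by auto
  then have "i \<le> n - 2 \<or> j \<le> n - 2" "n - 2 < n"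
    using ij by auto
  then show ?thesis
    using dec[of i "n - 2"] dec[of j "n - 2"] ij le by auto
qed

section \<open>Eigenvectors from Rayleigh quotients\<close>

lemma sum_delta_mult:
  fixes f :: "'a \<Rightarrow> real"
  assumes "finite I" "m \<in> I"
  shows "(\<Sum>i\<in>I. f i * (if i = m then 1 else 0)) = f m"
  using assms by (simp add: if_distrib[of "\<lambda>t. _ * t"] sum.delta cong: if_cong)

text \<open>A quadratic in \<open>s\<close> that is nonnegative and vanishes at \<open>s = 0\<close>
  has a minimum there, so its derivative is zero.\<close>

lemma linear_coefficient_zero:
  fixes r c :: real
  assumes "\<And>s. 0 \<le> 2 * s * r + s\<^sup>2 * c"
  shows "r = 0"
proof (rule ccontr)
  assume "r \<noteq> 0"
  \<comment> \<open>With \<open>b\<close> positive and above \<open>c\<close>, the point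
    \<open>s = - r / b\<close> gives the value \<open>(r / b)^2 * (c - 2 * b)\<close>, which is
    negative.\<close>
  define b where "b = \<bar>c\<bar> + 1"
  have b: "b > 0" "c < b"
    by (auto simp: b_def)
  have "2 * (- r / b) * r + (- r / b)\<^sup>2 * c = (r / b)\<^sup>2 * (c - 2 * b)"
    using b by (simp add: field_simps power2_eq_square)
  also have "\<dots> < 0"
    using b \<open>r \<noteq> 0\<close> by (intro mult_pos_neg) auto
  finally show False
    using assms[of "- r / b"] by simp
qed

text \<open>The index type may be infinite, so the sphere is taken among functions pinned to zero
  outside \<open>I\<close>. It is a closed subset of a product of intervals and singletons, which is
  compact by Tychonoff.\<close>

lemma compact_unit_sphere_on:
  assumes "finite I"
  shows "compact {x :: 'i \<Rightarrow> real. (\<Sum>i\<in>I. (x i)\<^sup>2) = 1 \<and> (\<forall>i. i \<notin> I \<longrightarrow> x i = 0)}"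
proof -
  let ?K = "PiE UNIV (\<lambda>i. if i \<in> I then {-1..1} else {0 :: real})"
  let ?S = "{x :: 'i \<Rightarrow> real. (\<Sum>i\<in>I. (x i)\<^sup>2) = 1}"
  have "compactin (product_topology (\<lambda>i. euclidean) UNIV) ?K"
    unfolding compactin_PiE by auto
  then have "compact ?K"
    by (simp add: euclidean_product_topology)
  moreover have "closed ?S"
    by (intro closed_Collect_eq continuous_intros continuous_on_product_coordinates)
  ultimately have "compact (?K \<inter> ?S)"
    by (rule compact_Int_closed)
  moreover have "{x. (\<Sum>i\<in>I. (x i)\<^sup>2) = 1 \<and> (\<forall>i. i \<notin> I \<longrightarrow> x i = 0)} = ?K \<inter> ?S"
  proof -
    have "\<bar>x i\<bar> \<le> 1" if "(\<Sum>i\<in>I. (x i)\<^sup>2) = 1" "i \<in> I" for x :: "'i \<Rightarrow> real" and i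
      using member_le_sum[of i I "\<lambda>i. (x i)\<^sup>2"] that assms
      by (simp add: abs_square_le_1)
    then show ?thesis
      by (force simp: PiE_iff abs_le_iff split: if_splits)
  qed
  ultimately show ?thesis
    by simp
qed

text \<open>The quadratic form attains its maximum on the unit sphere. A maximiser is an
  eigenvector, and its eigenvalue is the maximum, hence at least the Rayleigh quotient of
  \<open>y\<close>.\<close>

lemma ex_eigenvector_ge_rayleigh:
  fixes a :: "'i \<Rightarrow> 'i \<Rightarrow> real"
  assumes fin: "finite I"
    and sym: "\<And>i j. i \<in> I \<Longrightarrow> j \<in> I \<Longrightarrow> a i j = a j i"
    and y: "\<exists>i\<in>I. y i \<noteq> 0"
    and le: "t * (\<Sum>i\<in>I. (y i)\<^sup>2) \<le> (\<Sum>i\<in>I. \<Sum>j\<in>I. a i j * y i * y j)"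
  shows "\<exists>x k. t \<le> k \<and> (\<exists>i\<in>I. x i \<noteq> 0) \<and> (\<forall>i\<in>I. (\<Sum>j\<in>I. a i j * x j) = k * x i)"
proof -
  define N where "N z = (\<Sum>i\<in>I. (z i)\<^sup>2)" for z :: "'i \<Rightarrow> real"
  define q where "q z = (\<Sum>i\<in>I. \<Sum>j\<in>I. a i j * z i * z j)" for z :: "'i \<Rightarrow> real"
  let ?S = "{x. N x = 1 \<and> (\<forall>i. i \<notin> I \<longrightarrow> x i = 0)}"
  have N_pos: "N z > 0" if "i \<in> I" "z i \<noteq> 0" for z i
    unfolding N_def using that fin by (intro sum_pos2[of I i]) auto
  define nz where "nz z = (\<lambda>i. if i \<in> I then z i / sqrt (N z) else 0)" for z
  have nz: "nz z \<in> ?S" "q (nz z) = q z / N z" if "N z > 0" for z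
  proof -
    have "N (nz z) = (\<Sum>i\<in>I. (z i)\<^sup>2 / N z)"
      unfolding N_def[of "nz z"] using that by (intro sum.cong) (auto simp: nz_def power_divide)
    then show "nz z \<in> ?S"
      using that by (simp add: N_def nz_def flip: sum_divide_distrib)
    have "a i j * nz z i * nz z j = a i j * z i * z j / N z" if "i \<in> I" "j \<in> I" for i j
      using that \<open>N z > 0\<close> by (simp add: nz_def)
    then have "q (nz z) = (\<Sum>i\<in>I. \<Sum>j\<in>I. a i j * z i * z j / N z)"
      unfolding q_def by (intro sum.cong) auto
    then show "q (nz z) = q z / N z"
      by (simp add: q_def flip: sum_divide_distrib)
  qed
  have Ny: "N y > 0"
    using y N_pos by auto
  have "compact ?S"
    unfolding N_def by (rule compact_unit_sphere_on[OF fin])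
  moreover have "?S \<noteq> {}"
    using nz(1)[OF Ny] by blast
  moreover have "continuous_on ?S q"
    unfolding q_def
    by (intro continuous_intros continuous_on_subset[OF continuous_on_product_coordinates]) auto
  ultimately obtain x where x: "x \<in> ?S" and max: "\<And>z. z \<in> ?S \<Longrightarrow> q z \<le> q x"
    using continuous_attains_sup[of ?S q] by blast
  \<comment> \<open>Homogeneity of degree two carries maximality from the sphere to all
    vectors.\<close>
  have bound: "q z \<le> q x * N z" for z
  proof (cases "\<exists>i\<in>I. z i \<noteq> 0")
    case True
    then have "N z > 0"
      using N_pos by auto
    with max[OF nz(1)] nz(2) show ?thesis
      by (metis pos_divide_le_eq)
  next
    case False
    then show ?thesis
      by (simp add: q_def N_def)
  qed
  show ?thesis
  proof (intro exI conjI ballI)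
    have "t * N y \<le> q x * N y"
      using le bound[of y] by (simp add: N_def q_def)
    then show "t \<le> q x"
      using Ny by simp
    show "\<exists>i\<in>I. x i \<noteq> 0"
      using x by (auto simp: N_def intro: ccontr)
    fix m
    assume m: "m \<in> I"
    \<comment> \<open>The maximiser is perturbed in each coordinate direction \<open>m\<close>; the
      first-order condition is the eigenvector equation at \<open>m\<close>.\<close>
    define e :: "'i \<Rightarrow> real" where "e i = (if i = m then 1 else 0)" for i
    have e: "(\<Sum>i\<in>I. f i * e i) = f m" for f
      unfolding e_def by (rule sum_delta_mult[OF fin m])
    define p where "p = (\<Sum>j\<in>I. a m j * x j)"
    have N_eq: "N (\<lambda>i. x i + s * e i) = 1 + 2 * s * x m + s\<^sup>2" for s
    proof -
      have "N (\<lambda>i. x i + s * e i) = (\<Sum>i\<in>I. (x i)\<^sup>2 + (2 * s * x i) * e i + s\<^sup>2 * e i)"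
        unfolding N_def
        by (intro sum.cong refl) (auto simp: e_def power2_eq_square algebra_simps)
      also have "\<dots> = N x + 2 * s * x m + s\<^sup>2"
        by (simp add: sum.distrib e N_def)
      finally show ?thesis
        using x by simp
    qed
    \<comment> \<open>Both mixed terms equal \<open>s * p\<close>, by symmetry of
      \<open>a\<close>.\<close>
    have q_eq: "q (\<lambda>i. x i + s * e i) = q x + 2 * s * p + s\<^sup>2 * a m m" for s
    proof -
      have "q (\<lambda>i. x i + s * e i) = (\<Sum>i\<in>I. \<Sum>j\<in>I. a i j * x i * x j + (s * a i j * x i) * e j
          + (s * (a i j * x j)) * e i + (s\<^sup>2 * a i j * e i) * e j)"
        unfolding q_def
        by (intro sum.cong refl) (simp add: power2_eq_square algebra_simps)
      also have "\<dots> = q x + (\<Sum>i\<in>I. s * a i m * x i) + s * (\<Sum>j\<in>I. a m j * x j) + s\<^sup>2 * a m m"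
        by (simp add: sum.distrib e q_def sum_distrib_left flip: sum_distrib_right)
      also have "(\<Sum>i\<in>I. s * a i m * x i) = s * p"
        unfolding p_def sum_distrib_left using m sym by (intro sum.cong) (auto simp: mult_ac)
      finally show ?thesis
        by (simp add: p_def)
    qed
    \<comment> \<open>the form \<open>q x * N z - q z\<close> is nonnegative and vanishes at \<open>x\<close>, so its derivative there is zero\<close>
    have "0 \<le> 2 * s * (q x * x m - p) + s\<^sup>2 * (q x - a m m)" for s
      using bound[of "\<lambda>i. x i + s * e i"] unfolding N_eq q_eq by (simp add: algebra_simps)
    then have "q x * x m - p = 0"
      by (rule linear_coefficient_zero)
    then show "(\<Sum>j\<in>I. a m j * x j) = q x * x m"
      by (simp add: p_def)
  qed
qed

section \<open>Weighted Laplacians, and eigenvectors indexed by vertices\<close>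

text \<open>General weights cover both matrices at once: with distances as weights this is the
  distance Laplacian, with the 0/1 adjacency it is the ordinary one. A weight \<open>w i i\<close>
  cancels on the diagonal.\<close>

definition laplacian :: "'i set \<Rightarrow> ('i \<Rightarrow> 'i \<Rightarrow> real) \<Rightarrow> 'i \<Rightarrow> 'i \<Rightarrow> real" where
  "laplacian I w i j = (if i = j then (\<Sum>k\<in>I. w i k) else 0) - w i j"

lemma laplacian_sym:
  "w i j = w j i \<Longrightarrow> laplacian I w i j = laplacian I w j i"
  by (simp add: laplacian_def)

lemma sum_laplacian_mult:
  assumes "finite I" "i \<in> I"
  shows "(\<Sum>j\<in>I. laplacian I w i j * x j) = (\<Sum>j\<in>I. w i j) * x i - (\<Sum>j\<in>I. w i j * x j)"
proof -
  have "(\<Sum>j\<in>I. laplacian I w i j * x j) =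
      (\<Sum>j\<in>I. (if i = j then (\<Sum>k\<in>I. w i k) * x i else 0) - w i j * x j)"
    by (intro sum.cong) (auto simp: laplacian_def algebra_simps)
  then show ?thesis
    using assms by (simp add: sum_subtractf)
qed

text \<open>Expanding the squares gives two pure terms, equal by symmetry, and a cross term. The
  factor 2 appears because every unordered pair is summed in both orders.\<close>

lemma laplacian_quadratic_form:
  assumes "finite I" and sym: "\<And>i j. i \<in> I \<Longrightarrow> j \<in> I \<Longrightarrow> w i j = w j i"
  shows "2 * (\<Sum>i\<in>I. \<Sum>j\<in>I. laplacian I w i j * x i * x j) = (\<Sum>i\<in>I. \<Sum>j\<in>I. w i j * (x i - x j)\<^sup>2)"
proof -
  have "(\<Sum>j\<in>I. laplacian I w i j * x i * x j) = (\<Sum>j\<in>I. w i j * (x i)\<^sup>2) - (\<Sum>j\<in>I. w i j * x i * x j)"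
    if "i \<in> I" for i
  proof -
    have "(\<Sum>j\<in>I. laplacian I w i j * x i * x j) = x i * (\<Sum>j\<in>I. laplacian I w i j * x j)"
      by (simp add: sum_distrib_left mult_ac)
    then show ?thesis
      unfolding sum_laplacian_mult[OF assms(1) that]
      by (simp add: right_diff_distrib sum_distrib_left sum_distrib_right power2_eq_square mult_ac)
  qed
  then have eq: "(\<Sum>i\<in>I. \<Sum>j\<in>I. laplacian I w i j * x i * x j) =
      (\<Sum>i\<in>I. \<Sum>j\<in>I. w i j * (x i)\<^sup>2) - (\<Sum>i\<in>I. \<Sum>j\<in>I. w i j * x i * x j)"
    by (simp add: sum_subtractf)
  have "(\<Sum>i\<in>I. \<Sum>j\<in>I. w i j * (x j)\<^sup>2) = (\<Sum>i\<in>I. \<Sum>j\<in>I. w i j * (x i)\<^sup>2)"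
    by (subst sum.swap) (intro sum.cong refl, use sym in auto)
  moreover have "(\<Sum>i\<in>I. \<Sum>j\<in>I. w i j * (x i - x j)\<^sup>2) =
      (\<Sum>i\<in>I. \<Sum>j\<in>I. w i j * (x i)\<^sup>2) + (\<Sum>i\<in>I. \<Sum>j\<in>I. w i j * (x j)\<^sup>2)
      - 2 * (\<Sum>i\<in>I. \<Sum>j\<in>I. w i j * x i * x j)"
    unfolding sum_distrib_left sum.distrib[symmetric] sum_subtractf[symmetric]
    by (intro sum.cong refl) (simp add: power2_eq_square algebra_simps)
  ultimately show ?thesis
    using eq by simp
qed

text \<open>The star centred at \<open>c\<close> supplies the test vector: \<open>D\<close> at the
  centre and -1 at the \<open>D\<close> leaves. Its squared norm is \<open>D * (D + 1)\<close>,
  while the star edges alone contribute \<open>D * (D + 1)^2\<close> to the form.\<close>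

lemma laplacian_eigenvalue_ge_degree:
  fixes E :: "'i \<Rightarrow> 'i \<Rightarrow> bool"
  assumes fin: "finite I" and c: "c \<in> I"
    and sym: "\<And>i j. E i j \<Longrightarrow> E j i" and irr: "\<And>i. \<not> E i i"
    and ne: "{i\<in>I. E c i} \<noteq> {}"
  shows "\<exists>x k. 1 + real (card {i\<in>I. E c i}) \<le> k \<and> (\<exists>i\<in>I. x i \<noteq> 0) \<and> (\<Sum>i\<in>I. x i) = 0 \<and>
    (\<forall>i\<in>I. (\<Sum>j\<in>I. laplacian I (\<lambda>i j. of_bool (E i j)) i j * x j) = k * x i)"
proof -
  let ?w = "\<lambda>i j. of_bool (E i j) :: real"
  define M where "M = {i\<in>I. E c i}"
  define D where "D = real (card M)"
  have M: "finite M" "c \<notin> M" "M \<subseteq> I" "M \<noteq> {}"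
    using fin irr ne by (auto simp: M_def)
  then have D: "D > 0"
    by (simp add: D_def card_gt_0_iff)
  have wsym: "?w i j = ?w j i" for i j
    using sym by auto
  define y where "y i = (if i = c then D else if i \<in> M then -1 else 0)" for i
  have on_star: "(\<Sum>i\<in>I. f i) = f c + (\<Sum>i\<in>M. f i)" if "\<And>i. i \<in> I \<Longrightarrow> i \<noteq> c \<Longrightarrow> i \<notin> M \<Longrightarrow> f i = 0"
    for f :: "'i \<Rightarrow> real"
  proof -
    have "(\<Sum>i\<in>I. f i) = (\<Sum>i\<in>insert c M. f i)"
      using M c fin that by (intro sum.mono_neutral_right) auto
    then show ?thesis
      using M by simp
  qed
  have y_M: "y i = -1" if "i \<in> M" for i
    using that M(2) by (auto simp: y_def)
  have "(\<Sum>i\<in>I. (y i)\<^sup>2) = D * (D + 1)"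
    by (subst on_star) (auto simp: y_def[of c] y_M, auto simp: y_def D_def power2_eq_square algebra_simps)
  \<comment> \<open>Only the star edges are kept, each in both orientations: \<open>F c\<close>
    counts those leaving the centre, the \<open>F i\<close> with \<open>i\<close> in
    \<open>M\<close> those entering it. Across each the difference of values is \<open>D + 1\<close>
    in absolute value.\<close>
  moreover have "2 * (D * (D + 1)\<^sup>2) \<le> (\<Sum>i\<in>I. \<Sum>j\<in>I. ?w i j * (y i - y j)\<^sup>2)"
  proof -
    define F where "F i = (\<Sum>j\<in>I. ?w i j * (y i - y j)\<^sup>2)" for i
    have "F c = (\<Sum>j\<in>M. (D + 1)\<^sup>2)"
      unfolding F_def M_def
      by (rule sum.mono_neutral_cong_right) (use fin irr in \<open>auto simp: y_def M_def\<close>)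
    then have "F c = D * (D + 1)\<^sup>2"
      by (simp add: D_def)
    moreover have "(D + 1)\<^sup>2 \<le> F i" if i: "i \<in> M" for i
    proof -
      have "?w i c * (y i - y c)\<^sup>2 \<le> F i"
        unfolding F_def by (rule member_le_sum[OF c _ fin]) auto
      moreover have "E i c"
        using i sym by (auto simp: M_def)
      ultimately show ?thesis
        using y_M[OF i] by (simp add: y_def power2_eq_square algebra_simps)
    qed
    then have "D * (D + 1)\<^sup>2 \<le> sum F M"
      using sum_bounded_below[of M "(D + 1)\<^sup>2" F] by (simp add: D_def)
    moreover have "sum F (insert c M) \<le> sum F I"
      using M c fin by (intro sum_mono2) (auto simp: F_def intro: sum_nonneg)
    ultimately show ?thesis
      using M by (simp add: F_def)
  qed
  ultimately have ray: "(1 + D) * (\<Sum>i\<in>I. (y i)\<^sup>2) \<le> (\<Sum>i\<in>I. \<Sum>j\<in>I. laplacian I ?w i j * y i * y j)"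
    using laplacian_quadratic_form[of I ?w y, OF fin wsym]
    by (simp add: power2_eq_square algebra_simps)
  have "\<exists>i\<in>I. y i \<noteq> 0"
    using c D by (auto simp: y_def)
  then obtain x k where x: "1 + D \<le> k" "\<exists>i\<in>I. x i \<noteq> 0"
    and eig: "\<forall>i\<in>I. (\<Sum>j\<in>I. laplacian I ?w i j * x j) = k * x i"
    using ex_eigenvector_ge_rayleigh[of I "laplacian I ?w" y, OF fin laplacian_sym[of ?w, OF wsym] _ ray]
    by blast
  \<comment> \<open>The eigenvector equation is summed over \<open>I\<close>. The column sums of the
    Laplacian vanish, so \<open>k\<close> times the sum of \<open>x\<close> is zero, and
    \<open>k\<close> is positive.\<close>
  have "k * (\<Sum>i\<in>I. x i) = (\<Sum>i\<in>I. (\<Sum>j\<in>I. ?w i j) * x i - (\<Sum>j\<in>I. ?w i j * x j))"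
    unfolding sum_distrib_left using eig sum_laplacian_mult[OF fin, of _ ?w x] by (intro sum.cong) auto
  also have "\<dots> = (\<Sum>i\<in>I. \<Sum>j\<in>I. ?w i j * x i) - (\<Sum>i\<in>I. \<Sum>j\<in>I. ?w i j * x j)"
    by (simp add: sum_subtractf sum_distrib_right)
  also have "(\<Sum>i\<in>I. \<Sum>j\<in>I. ?w i j * x j) = (\<Sum>i\<in>I. \<Sum>j\<in>I. ?w i j * x i)"
    by (subst sum.swap) (simp add: wsym)
  finally have "(\<Sum>i\<in>I. x i) = 0"
    using x(1) D by simp
  with x eig show ?thesis
    unfolding D_def M_def by blast
qed

text \<open>This moves eigenvectors, given as functions on vertices, to the matrix ordered by
  \<open>vs\<close>. As \<open>vs\<close> has no repetitions, sums over positions are sums over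
  vertices.\<close>

lemma eigenvalue_mat_reindex:
  fixes a :: "'a \<Rightarrow> 'a \<Rightarrow> 'b :: comm_ring_1"
  assumes "distinct vs" and x: "\<exists>v\<in>set vs. x v \<noteq> 0"
    and eig: "\<And>u. u \<in> set vs \<Longrightarrow> (\<Sum>v\<in>set vs. a u v * x v) = k * x u"
  shows "eigenvalue (mat (length vs) (length vs) (\<lambda>(i, j). a (vs ! i) (vs ! j))) k"
proof -
  let ?x = "vec (length vs) (\<lambda>i. x (vs ! i))"
  have row: "(\<Sum>j<length vs. a u (vs ! j) * x (vs ! j)) = (\<Sum>v\<in>set vs. a u v * x v)" for u
    using sum.reindex_bij_betw[OF bij_betw_nth[OF assms(1) refl refl], of "\<lambda>v. a u v * x v"] .
  have "?x \<noteq> 0\<^sub>v (length vs)"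
    using x by (auto simp: in_set_conv_nth vec_eq_iff)
  moreover have "mat (length vs) (length vs) (\<lambda>(i, j). a (vs ! i) (vs ! j)) *\<^sub>v ?x = k \<cdot>\<^sub>v ?x"
    by (rule eq_vecI) (auto simp: scalar_prod_def atLeast0LessThan row eig)
  ultimately show ?thesis
    unfolding eigenvalue_def eigenvector_def by (intro exI[of _ ?x]) simp
qed

section \<open>Small distances, degrees and extremal sets in graphs\<close>

lemma gdist_eq_0:
  assumes "graph G" "Digraph_Component.connected G" "u \<in> verts G"
  shows "gdist G u u = 0"
proof -
  interpret graph G by fact
  have "(LEAST k. \<exists>p. apath u p u \<and> length p = k) = 0"
    using assms(3) by (intro Least_equality) (auto simp: apath_Nil_iff)
  then show ?thesis
    using gdist_eq_Least(2)[OF assms(1,2,3,3)] by simp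
qed

lemma gdist_eq_1:
  assumes "graph G" "Digraph_Component.connected G" "(u, v) \<in> arcs_ends G"
  shows "gdist G u v = 1"
proof -
  interpret graph G by fact
  have uv: "u \<in> verts G" "v \<in> verts G" "u \<noteq> v"
    using assms(3) adj_in_verts adj_not_same by auto
  obtain e where "e \<in> arcs G" "tail G e = u" "head G e = v"
    using assms(3) by (auto simp: arcs_ends_conv)
  then have "apath u [e] v"
    using uv by (simp add: apath_simps)
  then have "\<exists>p. apath u p v \<and> length p = 1"
    by force
  moreover have "1 \<le> length p" if "apath u p v" for p
    using that uv by (cases p) (auto simp: apath_Nil_iff)
  ultimately have "(LEAST k. \<exists>p. apath u p v \<and> length p = k) = 1"
    by (intro Least_equality) auto
  then show ?thesis
    using gdist_eq_Least(2)[OF assms(1,2) uv(1,2)] by simp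
qed

text \<open>A shortest path exists by connectedness. With no arc it would force
  \<open>u = v\<close>, with one arc it would make \<open>u\<close> and \<open>v\<close>
  adjacent.\<close>

lemma gdist_ge_2:
  assumes "graph G" "Digraph_Component.connected G" "u \<in> verts G" "v \<in> verts G"
    and "u \<noteq> v" "(u, v) \<notin> arcs_ends G"
  shows "2 \<le> gdist G u v"
proof -
  interpret graph G by fact
  have "strongly_connected G"
    using assms(2) by (rule symmetric_connected_imp_strongly_connected[OF sym_arcs])
  then have "u \<rightarrow>\<^sup>*\<^bsub>G\<^esub> v"
    using assms(3,4) by (auto simp: strongly_connected_def)
  then have "\<exists>p. apath u p v"
    by (simp add: reachable_apath)
  then have "\<exists>k p. apath u p v \<and> length p = k"
    by auto
  from LeastI_ex[OF this] obtain p
    where p: "apath u p v" "length p = (LEAST k. \<exists>p. apath u p v \<and> length p = k)"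
    by auto
  have "2 \<le> length p"
  proof (rule ccontr)
    assume "\<not> 2 \<le> length p"
    then consider "p = []" | e where "p = [e]"
      by (cases p; cases "tl p") auto
    then show False
      using p(1) assms(5,6) by cases (auto simp: apath_simps arcs_ends_conv)
  qed
  then show ?thesis
    using p(2) gdist_eq_Least(2)[OF assms(1-4)] by simp
qed

text \<open>Without parallel arcs, \<open>head\<close> is injective on the arcs leaving
  \<open>v\<close>, and its image is the neighbourhood.\<close>

lemma out_degree_eq_card_neighbours:
  assumes "graph G"
  shows "out_degree G v = card {u \<in> verts G. (v, u) \<in> arcs_ends G}"
proof -
  interpret graph G by fact
  have "inj_on (head G) (out_arcs G v)"
    using no_multi_arcs by (auto simp: inj_on_def out_arcs_def arc_to_ends_def)
  moreover have "head G ` out_arcs G v = {u \<in> verts G. (v, u) \<in> arcs_ends G}"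
    by (auto simp: out_arcs_def arcs_ends_conv)
  ultimately show ?thesis
    unfolding out_degree_def by (metis card_image)
qed

lemma ex_max_independent_set:
  assumes "finite (verts G)"
  shows "\<exists>S. independent_set G S \<and> card S = independence_number G \<and>
    (\<forall>T. independent_set G T \<longrightarrow> card T \<le> independence_number G)"
proof -
  have fin: "finite {S. independent_set G S}"
    using assms by (rule_tac finite_subset[of _ "Pow (verts G)"]) (auto simp: independent_set_def)
  moreover have "independent_set G {}"
    by (simp add: independent_set_def)
  ultimately have "independence_number G \<in> card ` {S. independent_set G S}"
    unfolding independence_number_def by (intro Max_in) auto
  with fin show ?thesis
    by (auto simp: independence_number_def)
qed

lemma ex_max_degree:
  assumes "finite (verts G)" "verts G \<noteq> {}"
  shows "\<exists>c\<in>verts G. out_degree G c = max_degree G \<and>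
    (\<forall>v\<in>verts G. out_degree G v \<le> max_degree G)"
proof -
  have "max_degree G \<in> out_degree G ` verts G"
    unfolding max_degree_def using assms by (intro Max_in) auto
  with assms(1) show ?thesis
    by (auto simp: max_degree_def)
qed

lemma
  assumes "finite (verts G)" "verts G \<noteq> {}"
  shows gdist_le_diameter: "\<And>u v. u \<in> verts G \<Longrightarrow> v \<in> verts G \<Longrightarrow> gdist G u v \<le> diameter G"
    and ex_gdist_eq_diameter: "\<exists>u\<in>verts G. \<exists>v\<in>verts G. gdist G u v = diameter G"
proof -
  have eq: "{gdist G u v | u v. u \<in> verts G \<and> v \<in> verts G} = (\<lambda>(u, v). gdist G u v) ` (verts G \<times> verts G)"
    by auto
  have fin: "finite {gdist G u v | u v. u \<in> verts G \<and> v \<in> verts G}"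
    unfolding eq using assms(1) by simp
  show "gdist G u v \<le> diameter G" if "u \<in> verts G" "v \<in> verts G" for u v
    unfolding diameter_def using that by (intro Max_ge[OF fin]) auto
  have "diameter G \<in> {gdist G u v | u v. u \<in> verts G \<and> v \<in> verts G}"
    unfolding diameter_def using assms(2) by (intro Max_in[OF fin]) auto
  then show "\<exists>u\<in>verts G. \<exists>v\<in>verts G. gdist G u v = diameter G"
    by (auto intro: sym)
qed

section \<open>The spread bound in diameter 2\<close>

theorem theorem4p5:
  fixes G :: "('a, 'b) pre_digraph" and vs :: "'a list" and n :: nat
  assumes "graph G"
    and "Digraph_Component.connected G"
    and "distinct vs" and "set vs = verts G"
    and "n = card (verts G)"
    and "diameter G = 2"
  shows "DLS G vs \<ge> real (max_degree G) + real (independence_number G) + 1 - real n"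
proof -
  interpret graph G by fact
  let ?V = "verts G"
  let ?d = "gdist G"
  let ?A = "distance_Laplacian G vs"
  have fin: "finite ?V"
    by simp
  have len: "length vs = n"
    using assms(3-5) distinct_card by metis
  have "?V \<noteq> {}"
    using assms(2) by (auto simp: Digraph_Component.connected_def strongly_connected_def)
  note diam = gdist_le_diameter[OF fin this, unfolded assms(6)]
    ex_gdist_eq_diameter[OF fin this, unfolded assms(6)]
  \<comment> \<open>For distinct non-adjacent vertices the diameter bounds the distance by 2 from
    above and \<open>gdist_ge_2\<close> from below.\<close>
  have d: "?d u v = (if u = v then 0 else if (u, v) \<in> arcs_ends G then 1 else 2)"
    if "u \<in> ?V" "v \<in> ?V" for u v
    using that gdist_eq_0[OF assms(1,2)] gdist_eq_1[OF assms(1,2)] gdist_ge_2[OF assms(1,2)] diam(1)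
    by (metis antisym)
  have adj_sym: "(v, u) \<in> arcs_ends G" if "(u, v) \<in> arcs_ends G" for u v
    using that sym_arcs arcs_ends_symmetric by metis
  have adj_irr: "(u, u) \<notin> arcs_ends G" for u
    using adj_not_same by blast
  have d_sym: "?d u v = ?d v u" if "u \<in> ?V" "v \<in> ?V" for u v
    using d that adj_sym by auto
  define a where "a = laplacian ?V ?d"
  have a_sym: "a u v = a v u" if "u \<in> ?V" "v \<in> ?V" for u v
    unfolding a_def using that by (intro laplacian_sym d_sym)
  have A_eq: "?A = mat (length vs) (length vs) (\<lambda>(i, j). a (vs ! i) (vs ! j))"
  proof (rule eq_matI, goal_cases)
    case (1 i j)
    then have ij: "i < length vs" "j < length vs"
      by auto
    then have "vs ! i \<in> ?V" "vs ! i = vs ! j \<longleftrightarrow> i = j"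
      using assms(3,4) nth_eq_iff_index_eq by (metis nth_mem)+
    \<comment> \<open>\<open>transmission\<close> sums over the first argument of the distance,
      \<open>laplacian\<close> over the second; symmetry reconciles them.\<close>
    moreover have "transmission G u = (\<Sum>v\<in>?V. ?d u v)" if "u \<in> ?V" for u
      unfolding transmission_def using that by (intro sum.cong) (auto simp: d_sym)
    ultimately show ?case
      using ij by (auto simp: distance_Laplacian_def transmission_matrix_def distance_matrix_def
          a_def laplacian_def)
  qed (auto simp: distance_Laplacian_def transmission_matrix_def distance_matrix_def)
  have A: "?A \<in> carrier_mat n n"
    unfolding A_eq len by simp
  have A_sym: "?A $$ (i, j) = ?A $$ (j, i)" if "i < n" "j < n" for i j
    using that a_sym assms(4) len nth_mem by (auto simp: A_eq intro!: a_sym)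
  have eigenvalueI: "eigenvalue ?A k"
    if "\<exists>v\<in>?V. x v \<noteq> 0" "\<And>u. u \<in> ?V \<Longrightarrow> (\<Sum>v\<in>?V. a u v * x v) = k * x u" for x k
    unfolding A_eq using that assms(3) by (intro eigenvalue_mat_reindex[where x = x]) (auto simp: assms(4))

  \<comment> \<open>A pair realising the diameter serves twice: it is an independent set of size 2,
    and, being connected by a walk, it shows that the graph has an edge.\<close>
  obtain p q where pq: "p \<in> ?V" "q \<in> ?V" "?d p q = 2"
    using diam(2) by auto
  then have pq': "p \<noteq> q" "(p, q) \<notin> arcs_ends G" "(q, p) \<notin> arcs_ends G"
    using d[of p q] adj_sym by (auto split: if_splits)

  have first: "real n + real (independence_number G) \<le> dL_eigenvalue G vs 1"
  proof -
    let ?\<alpha> = "real (independence_number G)"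
    obtain S where S: "independent_set G S" "card S = independence_number G"
      and max: "\<forall>T. independent_set G T \<longrightarrow> card T \<le> independence_number G"
      using ex_max_independent_set[OF fin] by blast
    have SV: "S \<subseteq> ?V"
      using S(1) by (simp add: independent_set_def)
    have "independent_set G {p, q}"
      using pq pq' by (auto simp: independent_set_def)
    then have "2 \<le> card S"
      using max[rule_format, of "{p, q}"] pq' S(2) by simp
    then obtain u v where uv: "u \<in> S" "v \<in> S" "u \<noteq> v"
      using card_le_Suc0_iff_eq[OF finite_subset[OF SV fin]] by fastforce
    then have uvV: "u \<in> ?V" "v \<in> ?V"
      using SV by auto
    \<comment> \<open>From \<open>w\<close> in \<open>S\<close> the distance is 0 to itself, 2 to
      the other members of \<open>S\<close>, and at least 1 to the remaining vertices: in total at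
      least \<open>2 * (\<alpha> - 1) + (n - \<alpha>)\<close>. The summand on the left encodes
      these values.\<close>
    have tr: "real n + ?\<alpha> - 2 \<le> (\<Sum>z\<in>?V. ?d w z)" if w: "w \<in> S" for w
    proof -
      have wV: "w \<in> ?V"
        using w SV by auto
      have "(\<Sum>z\<in>?V. 1 + of_bool (z \<in> S) - 2 * (if z = w then 1 else 0)) \<le> (\<Sum>z\<in>?V. ?d w z)"
        using w SV S(1) d[OF wV] by (intro sum_mono) (auto simp: independent_set_def)
      moreover have "(\<Sum>z\<in>?V. of_bool (z \<in> S)) = ?\<alpha>"
        using SV S(2) by (simp add: Int_absorb1)
      ultimately show ?thesis
        using sum_delta_mult[OF fin wV, of "\<lambda>_. 2"]
        by (simp add: sum.distrib sum_subtractf assms(5))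
    qed
    define y :: "'a \<Rightarrow> real" where "y z = (if z = u then 1 else 0) - (if z = v then 1 else 0)" for z
    have ysum: "(\<Sum>z\<in>?V. f z * y z) = f u - f v" for f
      using sum_delta_mult[OF fin uvV(1), of f] sum_delta_mult[OF fin uvV(2), of f]
      by (simp add: y_def right_diff_distrib sum_subtractf)
    have "(\<Sum>z\<in>?V. (y z)\<^sup>2) = 2"
      using ysum[of y] uv(3) by (simp add: power2_eq_square y_def)
    moreover have "(\<Sum>w\<in>?V. \<Sum>z\<in>?V. a w z * y w * y z) = a u u - a u v - (a v u - a v v)"
    proof -
      have "(\<Sum>w\<in>?V. \<Sum>z\<in>?V. a w z * y w * y z) = (\<Sum>w\<in>?V. (a w u - a w v) * y w)"
        by (simp add: ysum left_diff_distrib)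
      then show ?thesis
        by (simp add: ysum)
    qed
    \<comment> \<open>Members of \<open>S\<close> are non-adjacent, hence at distance 2, and the
      diagonal entries are the transmissions. The form at \<open>y\<close> is therefore at least
      \<open>2 * (n + \<alpha> - 2) + 4\<close>, which is \<open>n + \<alpha>\<close> times the
      squared norm 2.\<close>
    moreover have "a u v = -2" "a v u = -2" "real n + ?\<alpha> - 2 \<le> a u u" "real n + ?\<alpha> - 2 \<le> a v v"
      using uv S(1) d[OF uvV] d[OF uvV(2,1)] d[OF uvV(1,1)] d[OF uvV(2,2)] tr[of u] tr[of v]
      by (auto simp: a_def laplacian_def independent_set_def)
    ultimately have ray: "(real n + ?\<alpha>) * (\<Sum>z\<in>?V. (y z)\<^sup>2) \<le> (\<Sum>w\<in>?V. \<Sum>z\<in>?V. a w z * y w * y z)"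
      by simp
    have "\<exists>z\<in>?V. y z \<noteq> 0"
      using uv(3) uvV by (auto simp: y_def)
    then obtain x k where "real n + ?\<alpha> \<le> k" "\<exists>z\<in>?V. x z \<noteq> 0"
      "\<forall>z\<in>?V. (\<Sum>w\<in>?V. a z w * x w) = k * x z"
      using ex_eigenvector_ge_rayleigh[of ?V a y, OF fin a_sym _ ray] by blast
    then show ?thesis
      using eigenvalues_desc_first_ge[OF A eigenvalueI, of x k] by (simp add: dL_eigenvalue_def)
  qed

  have second: "dL_eigenvalue G vs (length vs - 1) \<le> 2 * real n - real (max_degree G) - 1"
  proof -
    let ?E = "\<lambda>u v. (u, v) \<in> arcs_ends G"
    let ?w = "\<lambda>u v. of_bool (?E u v) :: real"
    let ?N = "\<lambda>u. {v \<in> ?V. ?E u v}"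
    obtain c where c: "c \<in> ?V" "out_degree G c = max_degree G"
      and max: "\<forall>v\<in>?V. out_degree G v \<le> max_degree G"
      using ex_max_degree[OF fin \<open>?V \<noteq> {}\<close>] by blast
    have deg: "card (?N c) = max_degree G"
      using c(2) out_degree_eq_card_neighbours[OF assms(1)] by metis
    have "strongly_connected G"
      using assms(2) by (rule symmetric_connected_imp_strongly_connected[OF sym_arcs])
    then have "p \<rightarrow>\<^sup>*\<^bsub>G\<^esub> q"
      using pq by (auto simp: strongly_connected_def)
    \<comment> \<open>The first arc of a walk from \<open>p\<close> to \<open>q\<close> gives
      \<open>p\<close> a neighbour, so the maximum degree is positive and the neighbourhood of
      \<open>c\<close> is nonempty.\<close>
    then obtain r where "(p, r) \<in> arcs_ends G"
      using pq'(1) by (cases rule: converse_reachable_cases) auto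
    then have "r \<in> ?N p"
      using adj_in_verts by auto
    then have "0 < out_degree G p"
      unfolding out_degree_eq_card_neighbours[OF assms(1)] using fin by (auto simp: card_gt_0_iff)
    then have "?N c \<noteq> {}"
      using bspec[OF max pq(1)] deg by (metis card.empty le_zero_eq less_numeral_extra(3))
    then obtain x k where x: "1 + real (max_degree G) \<le> k" "\<exists>i\<in>?V. x i \<noteq> 0" "(\<Sum>i\<in>?V. x i) = 0"
      and eig: "\<forall>i\<in>?V. (\<Sum>j\<in>?V. laplacian ?V ?w i j * x j) = k * x i"
      using laplacian_eigenvalue_ge_degree[of ?V c ?E, OF fin c(1) adj_sym adj_irr] unfolding deg by blast
    have eig_d: "(\<Sum>v\<in>?V. a u v * x v) = (2 * real n - k) * x u" if u: "u \<in> ?V" for u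
    proof -
      \<comment> \<open>This is the entrywise form of \<open>D = 2 J - 2 I - A\<close>, with
        \<open>A\<close> the adjacency matrix. Applied to \<open>x\<close>, the term with
        \<open>J\<close> vanishes because the entries of \<open>x\<close> sum to zero.\<close>
      have duv: "?d u v = 2 - 2 * (if v = u then 1 else 0) - ?w u v" if "v \<in> ?V" for v
        using d[OF u that] adj_irr by auto
      have tr: "(\<Sum>v\<in>?V. ?d u v) = 2 * real n - 2 - (\<Sum>v\<in>?V. ?w u v)"
        using sum_delta_mult[OF fin u, of "\<lambda>_. 2"]
        by (simp add: duv sum_subtractf assms(5) del: sum_of_bool_eq)
      have dx: "(\<Sum>v\<in>?V. ?d u v * x v) = - 2 * x u - (\<Sum>v\<in>?V. ?w u v * x v)"
      proof -
        have "(\<Sum>v\<in>?V. ?d u v * x v) =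
            (\<Sum>v\<in>?V. 2 * x v - (2 * x v) * (if v = u then 1 else 0) - ?w u v * x v)"
          by (intro sum.cong refl) (simp add: duv algebra_simps)
        also have "\<dots> = 2 * (\<Sum>v\<in>?V. x v) - 2 * x u - (\<Sum>v\<in>?V. ?w u v * x v)"
          by (simp only: sum_subtractf sum_delta_mult[OF fin u] sum_distrib_left)
        finally show ?thesis
          using x(3) by simp
      qed
      show ?thesis
        using bspec[OF eig u] unfolding a_def sum_laplacian_mult[OF fin u] tr dx
        by (simp add: algebra_simps)
    qed
    have "eigenvalue ?A (2 * real n - k)"
      using x(2) eig_d by (rule eigenvalueI)
    moreover have "eigenvalue ?A 0"
      using \<open>?V \<noteq> {}\<close> sum_laplacian_mult[OF fin, of _ ?d "\<lambda>_. 1"]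
      by (intro eigenvalueI[of "\<lambda>_. 1"]) (auto simp: a_def)
    \<comment> \<open>This keeps the eigenvalue apart from the trivial 0, so that the two take
      different positions in the list. Otherwise the distance-weighted sum of squares would vanish
      at \<open>x\<close>; distinct vertices have positive distance, so \<open>x\<close> would be
      constant, and with sum zero it would be zero.\<close>
    moreover have "2 * real n - k \<noteq> 0"
    proof
      assume zero: "2 * real n - k = 0"
      have "(\<Sum>u\<in>?V. \<Sum>v\<in>?V. a u v * x u * x v) = (\<Sum>u\<in>?V. x u * (\<Sum>v\<in>?V. a u v * x v))"
        by (simp add: sum_distrib_left mult_ac)
      also have "\<dots> = 0"
        by (simp add: eig_d zero)
      finally have "(\<Sum>u\<in>?V. \<Sum>v\<in>?V. a u v * x u * x v) = 0" .
      then have "(\<Sum>u\<in>?V. \<Sum>v\<in>?V. ?d u v * (x u - x v)\<^sup>2) = 0"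
        using laplacian_quadratic_form[of ?V ?d x, OF fin d_sym] by (simp add: a_def)
      moreover have nonneg: "0 \<le> ?d u v * (x u - x v)\<^sup>2" if "u \<in> ?V" "v \<in> ?V" for u v
        using d that by auto
      ultimately have "?d u v * (x u - x v)\<^sup>2 = 0" if "u \<in> ?V" "v \<in> ?V" for u v
        using that fin by (simp add: sum_nonneg_eq_0_iff sum_nonneg)
      then have const: "x u = x v" if "u \<in> ?V" "v \<in> ?V" for u v
        using that d[OF that] by (fastforce split: if_splits)
      obtain u where u: "u \<in> ?V" "x u \<noteq> 0"
        using x(2) by auto
      have "(\<Sum>v\<in>?V. x v) = real n * x u"
        using const[OF _ u(1)] by (simp add: assms(5))
      then show False
        using x(3) u fin assms(5) by auto
    qed
    \<comment> \<open>The bound must also dominate the eigenvalue 0, that is,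
      \<open>2 * n - \<Delta> - 1\<close> must be nonnegative. A vertex is not its own neighbour, so
      \<open>\<Delta> < n\<close>.\<close>
    moreover have "real (max_degree G) + 1 \<le> real n"
    proof -
      have "card (?N c) < n"
        unfolding assms(5) using c(1) adj_irr fin by (intro psubset_card_mono) auto
      then show ?thesis
        using deg by simp
    qed
    ultimately have "eigenvalues_desc ?A ! (n - 2) \<le> 2 * real n - real (max_degree G) - 1"
      using x(1)
      by (intro eigenvalues_desc_second_last_le[OF A A_sym, where k = "2 * real n - k" and l = 0]) auto
    \<comment> \<open>\<open>dL_eigenvalue\<close> counts from 1, so its index \<open>n - 1\<close>
      is the list position \<open>n - 2\<close>.\<close>
    then show ?thesis
      by (simp add: dL_eigenvalue_def len numeral_2_eq_2)
  qed
  show ?thesis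
    using first second by (simp add: DLS_def)
qed

end
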